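(* Let $d\ge1$ be an integer, let $X$ be any Polish metric space that admits a bi-Lipschitz embedding of a Euclidean cube $I^d$ (e.g. any manifold of dimension $d$), and let $(a_n)_{n\ge1}$ be any $\ell^{\frac{2d}{d+2}}$ sequence of positive numbers. Then there is a bi-Lipschitz embedding of $\mathrm{HC}(I^d;(a_n))$ into $\mathscr{W}_2(X)$.
   Context: $I=[0,1]$, and $I^d$ carries the Euclidean metric. An $\ell^q$ sequence (any $q>0$) is one with $\sum_n|a_n|^q<\infty$. For a compact metric space $(Z,\rho)$ and an $\ell^2$ sequence $\bar a=(a_n)_{n\ge1}$ of positive reals, the generalized Hilbert cube $\mathrm{HC}(Z;\bar a)$ is the set $Z^{\mathbb N}$ of sequences $\bar x=(x_n)_{n\ge1}$ endowed with the metric $\big(\sum_{n=1}^\infty a_n^2\rho(x_n,y_n)^2\big)^{1/2}$. For a Polish (complete separable) metric space $(X,\rho)$, $\mathscr{W}_2(X)$ is the set of Borel probability measures $\mu$ on $X$ with $\int\rho(x_0,x)^2\mu(dx)<\infty$ for some (hence all) $x_0$, with the metric $\mathrm{W}_2(\mu,\nu)=\big(\inf_\Pi\int\rho(x,y)^2\,\Pi(dx\,dy)\big)^{1/2}$, the infimum being over probability measures $\Pi$ on $X\times X$ with marginals $\mu,\nu$. A map $g$ is a bi-Lipschitz embedding if there is $C\ge1$ such that distances satisfy $C^{-1}\mathrm{dist}(x,x')\le\mathrm{dist}(g(x),g(x'))\le C\,\mathrm{dist}(x,x')$ for all $x,x'$. "Manifold" means a manifold with a metric (e.g. a Riemannian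 distance) that is locally bi-Lipschitz equivalent to the Euclidean one in charts. *)

theory Defs
  imports "HOL-Probability.Probability"
begin

text \<open>Metric spaces other than type-class ones are given by a carrier set together with a
  distance function, as neither the Hilbert cube nor the Wasserstein space is a whole type.\<close>

definition bilipschitz_embedding ::
    "'a set \<Rightarrow> ('a \<Rightarrow> 'a \<Rightarrow> real) \<Rightarrow> 'b set \<Rightarrow> ('b \<Rightarrow> 'b \<Rightarrow> real) \<Rightarrow> ('a \<Rightarrow> 'b) \<Rightarrow> bool" where
  "bilipschitz_embedding S dS T dT g \<longleftrightarrow>
     g \<in> S \<rightarrow> T \<and>
     (\<exists>C\<ge>1. \<forall>x\<in>S. \<forall>y\<in>S. inverse C * dS x y \<le> dT (g x) (g y) \<and> dT (g x) (g y) \<le> C * dS x y)"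

definition unit_cube :: "(real ^ 'd) set" where
  "unit_cube = {x. \<forall>i. 0 \<le> x $ i \<and> x $ i \<le> 1}"

text \<open>Sequences are indexed from 0 instead of 1.\<close>

definition hilbert_cube :: "'a set \<Rightarrow> (nat \<Rightarrow> 'a) set" where
  "hilbert_cube Z = {x. \<forall>n. x n \<in> Z}"

text \<open>A genuine distance on the Hilbert cube over a compact set when \<open>a\<close> is square summable
  with positive terms; otherwise the series need not converge.\<close>

definition hilbert_cube_dist ::
    "(nat \<Rightarrow> real) \<Rightarrow> (nat \<Rightarrow> 'a::metric_space) \<Rightarrow> (nat \<Rightarrow> 'a) \<Rightarrow> real" where
  "hilbert_cube_dist a x y = sqrt (\<Sum>n. (a n)\<^sup>2 * (dist (x n) (y n))\<^sup>2)"

definition wasserstein2_space :: "'a::polish_space measure set" where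
  "wasserstein2_space =
     {\<mu>. prob_space \<mu> \<and> sets \<mu> = sets borel \<and>
         (\<exists>x0. (\<integral>\<^sup>+x. ennreal ((dist x0 x)\<^sup>2) \<partial>\<mu>) < \<infinity>)}"

definition couplings :: "'a::polish_space measure \<Rightarrow> 'a measure \<Rightarrow> ('a \<times> 'a) measure set" where
  "couplings \<mu> \<nu> =
     {P. prob_space P \<and> sets P = sets borel \<and>
         distr P borel fst = \<mu> \<and> distr P borel snd = \<nu>}"

text \<open>The cost is a nonnegative extended integral, so that an infinite cost is not read as 0.
  On \<^const>\<open>wasserstein2_space\<close> the infimum is finite and the conversion to \<^typ>\<open>real\<close> is
  harmless.\<close>

definition wasserstein2_dist :: "'a::polish_space measure \<Rightarrow> 'a measure \<Rightarrow> real" where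
  "wasserstein2_dist \<mu> \<nu> =
     sqrt (enn2real (INF P\<in>couplings \<mu> \<nu>. \<integral>\<^sup>+z. ennreal ((dist (fst z) (snd z))\<^sup>2) \<partial>P))"

text \<open>Charts of a metric manifold without boundary, of dimension \<open>CARD('d)\<close>: homeomorphisms between
  open sets in which the metric is locally bi-Lipschitz equivalent to the Euclidean one.\<close>

definition bilipschitz_chart :: "'a::metric_space set \<Rightarrow> ('a \<Rightarrow> real ^ 'd) \<Rightarrow> bool" where
  "bilipschitz_chart U \<phi> \<longleftrightarrow>
     open U \<and> open (\<phi> ` U) \<and> (\<exists>\<psi>. homeomorphism U (\<phi> ` U) \<phi> \<psi>) \<and>
     (\<forall>p\<in>U. \<exists>W. open W \<and> p \<in> W \<and> W \<subseteq> U \<and> bilipschitz_embedding W dist UNIV dist \<phi>)"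

definition bilipschitz_atlas :: "('a::metric_space set \<times> ('a \<Rightarrow> real ^ 'd)) set \<Rightarrow> bool" where
  "bilipschitz_atlas \<A> \<longleftrightarrow>
     (\<forall>(U, \<phi>)\<in>\<A>. bilipschitz_chart U \<phi>) \<and> (\<Union>(U, \<phi>)\<in>\<A>. U) = UNIV"

end

theory Submission
  imports Defs
begin

text \<open>
  Let \<open>f\<close> embed the cube. Choose positive weights \<open>w n\<close> of sum 1 and, inside the unit cube, homothetic
  copies \<open>h n\<close> of the cube whose side is \<open>r n / 16\<close>, such that the \<open>n\<close>-th copy lies at distance at
  least \<open>r n / 16\<close> from all others. A point \<open>x\<close> of the Hilbert cube is sent to the atomic
  probability measure that has mass \<open>w n\<close> at \<open>f (h n (x n))\<close>, for each \<open>n\<close>.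

  Moving, inside each copy, the atom of the image of \<open>x\<close> onto that of the image of \<open>y\<close> costs at most
  a constant times the sum of the \<open>w n * (r n * dist (x n) (y n))\<^sup>2\<close>. No transport plan is cheaper up to
  a constant: mass that starts in the \<open>n\<close>-th copy either ends at the atom of \<open>y\<close> in the same copy, at
  distance comparable to \<open>r n * dist (x n) (y n)\<close>, or leaves the copy and so travels at least a
  constant times \<open>r n\<close>, which is no better because the cube is bounded.
  Lemma \<open>wasserstein2_dist_atomic_bounds\<close> is this comparison.

  In order to recover the Hilbert cube distance one needs \<open>w n * (r n)\<^sup>2\<close> proportional to
  \<open>(a n)\<^sup>2\<close>, while the copies can be packed (lemma \<open>separated_points_in_unit_cube\<close>) when
  the \<open>r n ^ d\<close> are summable with controlled sum. Taking \<open>r n ^ d = w n\<close> satisfies both exactly when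
  \<open>w n\<close> is proportional to \<open>a n powr (2 * d / (d + 2))\<close>; this is where the exponent comes from.

  In a manifold, the inverse of a chart, restricted to a small cube in its range, embeds
  the cube.
\<close>

section \<open>Bi-Lipschitz embeddings\<close>

lemma bilipschitz_embeddingI:
  assumes "g \<in> S \<rightarrow> T" and "0 < A" and "0 < B"
    and nonneg: "\<And>x y. x \<in> S \<Longrightarrow> y \<in> S \<Longrightarrow> 0 \<le> dS x y"
    and lower: "\<And>x y. x \<in> S \<Longrightarrow> y \<in> S \<Longrightarrow> A * dS x y \<le> dT (g x) (g y)"
    and upper: "\<And>x y. x \<in> S \<Longrightarrow> y \<in> S \<Longrightarrow> dT (g x) (g y) \<le> B * dS x y"
  shows "bilipschitz_embedding S dS T dT g"
proof -
  define C where "C = max 1 (max B (inverse A))"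
  have C: "1 \<le> C" "B \<le> C" "inverse A \<le> C" by (auto simp: C_def)
  have CA: "inverse C \<le> A"
    using C(3) \<open>0 < A\<close> by (metis inverse_inverse_eq le_imp_inverse_le positive_imp_inverse_positive)
  have "inverse C * dS x y \<le> dT (g x) (g y) \<and> dT (g x) (g y) \<le> C * dS x y"
    if "x \<in> S" "y \<in> S" for x y
    using lower[OF that] upper[OF that] mult_right_mono[OF CA nonneg[OF that]]
      mult_right_mono[OF C(2) nonneg[OF that]] by linarith
  then show ?thesis
    using assms(1) C(1) unfolding bilipschitz_embedding_def by blast
qed

lemma dist_cart_le_component_bound:
  fixes x y :: "real ^ 'd::finite"
  assumes "\<And>i. \<bar>x $ i - y $ i\<bar> \<le> b"
  shows "dist x y \<le> real CARD('d) * b"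
proof -
  have "dist x y \<le> (\<Sum>i\<in>UNIV. \<bar>(x - y) $ i\<bar>)"
    unfolding dist_norm by (rule norm_le_l1_cart)
  also have "\<dots> \<le> (\<Sum>i\<in>(UNIV::'d set). b)"
    using assms by (intro sum_mono) auto
  finally show ?thesis by simp
qed

lemma unit_cube_dist_le:
  fixes x y :: "real ^ 'd::finite"
  assumes "x \<in> unit_cube" "y \<in> unit_cube"
  shows "dist x y \<le> real CARD('d)"
proof -
  have "\<bar>x $ i - y $ i\<bar> \<le> 1" for i
  proof -
    have "0 \<le> x $ i" "x $ i \<le> 1" "0 \<le> y $ i" "y $ i \<le> 1"
      using assms by (auto simp: unit_cube_def)
    then show ?thesis by linarith
  qed
  from dist_cart_le_component_bound[OF this] show ?thesis by simp
qed

text \<open>A chart is open, so its range around any point contains a ball, hence a small copy of the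
  cube. Shrinking the ball so that its preimage lies in a neighbourhood on which the chart is
  bi-Lipschitz, the inverse of the chart embeds this copy.\<close>

lemma bilipschitz_atlas_imp_cube_embedding:
  fixes \<A> :: "('x::metric_space set \<times> ('x \<Rightarrow> real ^ 'd::finite)) set"
  assumes "bilipschitz_atlas \<A>"
  shows "\<exists>f. bilipschitz_embedding (unit_cube :: (real ^ 'd) set) dist (UNIV :: 'x set) dist f"
proof -
  obtain p :: 'x where True by blast
  have "p \<in> (\<Union>(U, \<phi>)\<in>\<A>. U)" using assms by (simp add: bilipschitz_atlas_def)
  then obtain U \<phi> where "(U, \<phi>) \<in> \<A>" "p \<in> U" by blast
  then have chart: "bilipschitz_chart U \<phi>"
    using assms by (auto simp: bilipschitz_atlas_def)
  then obtain \<psi> W where "open (\<phi> ` U)" and hom: "homeomorphism U (\<phi> ` U) \<phi> \<psi>"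
    and W: "open W" "p \<in> W" "W \<subseteq> U"
    and "bilipschitz_embedding W dist UNIV dist \<phi>"
    using \<open>p \<in> U\<close> unfolding bilipschitz_chart_def by blast
  then obtain C where "1 \<le> C"
    and C: "\<And>u v. u \<in> W \<Longrightarrow> v \<in> W \<Longrightarrow>
        inverse C * dist u v \<le> dist (\<phi> u) (\<phi> v) \<and> dist (\<phi> u) (\<phi> v) \<le> C * dist u v"
    unfolding bilipschitz_embedding_def by blast
  have "openin (top_of_set (\<phi> ` U)) (\<phi> ` W)"
    using homeomorphism_imp_open_map[OF hom] W by (simp add: open_subset)
  then have "open (\<phi> ` W)"
    using \<open>open (\<phi> ` U)\<close> openin_open_eq by blast
  then obtain e where "0 < e" and e: "cball (\<phi> p) e \<subseteq> \<phi> ` W"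
    using \<open>p \<in> W\<close> open_contains_cball by blast
  define \<delta> where "\<delta> = e / real CARD('d)"
  have "0 < \<delta>" using \<open>0 < e\<close> by (simp add: \<delta>_def)
  define f where "f x = inv_into W \<phi> (\<phi> p + \<delta> *\<^sub>R x)" for x
  have mem: "\<phi> p + \<delta> *\<^sub>R x \<in> \<phi> ` W" if "x \<in> unit_cube" for x
  proof -
    have "dist x 0 \<le> real CARD('d)"
      using that by (intro unit_cube_dist_le) (auto simp: unit_cube_def)
    then have "\<delta> * norm x \<le> e"
      using \<open>0 < \<delta>\<close> mult_left_mono[of "norm x" "real CARD('d)" \<delta>] by (simp add: \<delta>_def)
    then have "\<phi> p + \<delta> *\<^sub>R x \<in> cball (\<phi> p) e"
      using \<open>0 < \<delta>\<close> by (simp add: dist_norm)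
    then show ?thesis using e by blast
  qed
  have f: "f x \<in> W" "\<phi> (f x) = \<phi> p + \<delta> *\<^sub>R x" if "x \<in> unit_cube" for x
    unfolding f_def using mem[OF that] by (auto intro: inv_into_into f_inv_into_f)
  have both: "\<delta> / C * dist x y \<le> dist (f x) (f y)" "dist (f x) (f y) \<le> C * \<delta> * dist x y"
    if "x \<in> unit_cube" "y \<in> unit_cube" for x y
  proof -
    have "dist (\<phi> (f x)) (\<phi> (f y)) = \<delta> * dist x y"
      using f(2) that \<open>0 < \<delta>\<close>
      by (simp add: dist_norm scaleR_diff_right[symmetric])
    then have "inverse C * dist (f x) (f y) \<le> \<delta> * dist x y"
        "\<delta> * dist x y \<le> C * dist (f x) (f y)"
      using C[OF f(1)[OF that(1)] f(1)[OF that(2)]] by auto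
    then show "\<delta> / C * dist x y \<le> dist (f x) (f y)" "dist (f x) (f y) \<le> C * \<delta> * dist x y"
      using \<open>1 \<le> C\<close> by (auto simp: field_simps)
  qed
  have "bilipschitz_embedding (unit_cube :: (real ^ 'd) set) dist (UNIV :: 'x set) dist f"
    using \<open>0 < \<delta>\<close> \<open>1 \<le> C\<close> both
    by (intro bilipschitz_embeddingI[where A = "\<delta> / C" and B = "C * \<delta>"]) auto
  then show ?thesis by blast
qed

section \<open>Separated points in the cube\<close>

text \<open>This order lists a null sequence of positive reals by decreasing value, ties being broken by
  index. It allows recursion from the largest term on, without rearranging the sequence: each term
  has finitely many predecessors.\<close>

lemma wf_decreasing_value_order:
  fixes s :: "nat \<Rightarrow> real"
  assumes "s \<longlonglongrightarrow> 0" and pos: "\<And>n. 0 < s n"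
  shows "wf {(m, n). s n < s m \<or> s n = s m \<and> m < n}" (is "wf ?R")
proof -
  define B where "B n = {m. (m, n) \<in> ?R}" for n
  have fin: "finite (B n)" for n
  proof -
    have "eventually (\<lambda>m. s m < s n) sequentially"
      using order_tendstoD(2)[OF assms(1) pos] .
    then obtain N where N: "\<And>m. N \<le> m \<Longrightarrow> s m < s n"
      by (auto simp: eventually_sequentially)
    have "m < N" if "m \<in> B n" for m
      using that N[of m] by (force simp: B_def not_less[symmetric])
    then show ?thesis by (meson bounded_nat_set_is_finite)
  qed
  have "B m \<subset> B n" if "(m, n) \<in> ?R" for m n
    using that by (auto simp: B_def)
  then have "card (B m) < card (B n)" if "(m, n) \<in> ?R" for m n
    by (rule psubset_card_mono[OF fin]) (rule that)
  then have "?R \<subseteq> inv_image less_than (\<lambda>n. card (B n))"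
    by (auto simp: inv_image_def)
  then show ?thesis by (rule wf_subset[rotated]) (intro wf_inv_image wf_less_than)
qed

lemma emeasure_unit_cube: "emeasure lborel (unit_cube :: (real ^ 'd::finite) set) = 1"
proof -
  have eq: "(unit_cube :: (real ^ 'd) set) = cbox 0 1"
    by (auto simp: unit_cube_def mem_box_cart)
  show ?thesis
    unfolding eq
    by (subst emeasure_lborel_cbox) (auto simp: Basis_vec_def inner_axis intro!: prod.neutral)
qed

text \<open>The points are chosen greedily, in the order of decreasing \<open>s\<close>: each new point must avoid the
  open cubes of side \<open>2 * s m\<close> around the earlier points \<open>z m\<close>. By the bound on the total volume these
  cubes do not cover the unit cube. As \<open>s m\<close> is the larger one of \<open>s m\<close> and \<open>s n\<close> whenever \<open>m\<close> is treated
  before \<open>n\<close>, the separation obtained is the maximum of the two.\<close>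

lemma separated_points_in_unit_cube:
  fixes s :: "nat \<Rightarrow> real"
  assumes pos: "\<And>n. 0 < s n"
    and summ: "summable (\<lambda>n. (2 * s n) ^ CARD('d::finite))"
    and vol: "(\<Sum>n. (2 * s n) ^ CARD('d)) < 1"
  obtains z :: "nat \<Rightarrow> real ^ 'd" where "\<And>n. z n \<in> unit_cube"
    and "\<And>m n. m \<noteq> n \<Longrightarrow> \<exists>i. max (s m) (s n) \<le> \<bar>z m $ i - z n $ i\<bar>"
proof -
  define R where "R = {(m, n). s n < s m \<or> s n = s m \<and> m < n}"
  define Q where "Q m c = box (c - (\<chi> i. s m)) (c + (\<chi> i. s m))" for m and c :: "real ^ 'd"
  have "(\<lambda>n. (2 * s n) ^ CARD('d)) \<longlonglongrightarrow> 0" using summ by (rule summable_LIMSEQ_zero)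
  then have "(\<lambda>n. root CARD('d) ((2 * s n) ^ CARD('d))) \<longlonglongrightarrow> root CARD('d) 0"
    by (intro tendsto_intros)
  moreover have "root CARD('d) ((2 * s n) ^ CARD('d)) = 2 * s n" for n
    using pos[of n] by (intro real_root_power_cancel) auto
  ultimately have "(\<lambda>n. 2 * s n) \<longlonglongrightarrow> 0" by simp
  then have "(\<lambda>n. (2 * s n) / 2) \<longlonglongrightarrow> 0 / 2" by (intro tendsto_intros) auto
  then have "s \<longlonglongrightarrow> 0" by simp
  then have "wf R" unfolding R_def using pos by (rule wf_decreasing_value_order)
  have volQ: "emeasure lborel (Q m c) = ennreal ((2 * s m) ^ CARD('d))" for m c
  proof -
    have side: "((c + (\<chi> i. s m)) - (c - (\<chi> i. s m))) \<bullet> b = 2 * s m"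
      if "b \<in> Basis" for b :: "real ^ 'd"
      using that by (auto simp: Basis_vec_def inner_axis)
    then have "(c - (\<chi> i. s m)) \<bullet> b \<le> (c + (\<chi> i. s m)) \<bullet> b" if "b \<in> Basis" for b :: "real ^ 'd"
      using that pos[of m] by (auto simp: Basis_vec_def inner_axis)
    then have "emeasure lborel (Q m c)
        = (\<Prod>b\<in>Basis. ((c + (\<chi> i. s m)) - (c - (\<chi> i. s m))) \<bullet> b)"
      unfolding Q_def by (rule emeasure_lborel_box)
    also have "\<dots> = ennreal (\<Prod>b\<in>(Basis :: (real ^ 'd) set). 2 * s m)"
      by (intro arg_cong[of _ _ ennreal] prod.cong refl side)
    finally show ?thesis by simp
  qed
  have free: "\<exists>c. c \<in> unit_cube \<and> (\<forall>m. (m, n) \<in> R \<longrightarrow> c \<notin> Q m (f m))"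
    for n and f :: "nat \<Rightarrow> real ^ 'd"
  proof (rule ccontr)
    assume "\<not> ?thesis"
    then have sub: "unit_cube \<subseteq> (\<Union>m. Q m (f m))" by blast
    have "emeasure lborel (unit_cube :: (real ^ 'd) set) \<le> emeasure lborel (\<Union>m. Q m (f m))"
      by (rule emeasure_mono[OF sub]) (auto simp: Q_def)
    also have "\<dots> \<le> (\<Sum>m. emeasure lborel (Q m (f m)))"
      by (rule emeasure_subadditive_countably) (auto simp: Q_def)
    also have "\<dots> = ennreal (\<Sum>m. (2 * s m) ^ CARD('d))"
      unfolding volQ using pos summ by (intro suminf_ennreal2) (auto simp: less_imp_le)
    finally show False using vol by (simp add: emeasure_unit_cube)
  qed
  have "\<exists>z. \<forall>n. z n \<in> unit_cube \<and> (\<forall>m. (m, n) \<in> R \<longrightarrow> z n \<notin> Q m (z m))"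
    by (rule dependent_wf_choice[OF \<open>wf R\<close>,
        where P = "\<lambda>f n c. c \<in> unit_cube \<and> (\<forall>m. (m, n) \<in> R \<longrightarrow> c \<notin> Q m (f m))"])
      (use free in auto)
  then obtain z :: "nat \<Rightarrow> real ^ 'd" where z: "\<And>n. z n \<in> unit_cube"
    "\<And>m n. (m, n) \<in> R \<Longrightarrow> z n \<notin> Q m (z m)"
    by blast
  have sep: "\<exists>i. max (s m) (s n) \<le> \<bar>z m $ i - z n $ i\<bar>" if mn: "(m, n) \<in> R" for m n
  proof -
    obtain i where "\<not> (z m $ i - s m < z n $ i \<and> z n $ i < z m $ i + s m)"
      using z(2)[OF mn] by (auto simp: Q_def mem_box_cart)
    moreover have "s n \<le> s m" using mn by (auto simp: R_def)
    ultimately show ?thesis by (intro exI[of _ i]) (auto simp: max_def)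
  qed
  have "\<exists>i. max (s m) (s n) \<le> \<bar>z m $ i - z n $ i\<bar>" if "m \<noteq> n" for m n
  proof -
    have "(m, n) \<in> R \<or> (n, m) \<in> R" using that by (auto simp: R_def)
    then show ?thesis using sep[of m n] sep[of n m]
      by (auto simp: abs_minus_commute max.commute)
  qed
  with z(1) show ?thesis by (rule that)
qed

section \<open>Distances between atomic measures\<close>

lemma diagonal_coupling:
  assumes "prob_space M" and [measurable]: "X \<in> borel_measurable M" "Y \<in> borel_measurable M"
  shows "distr M borel (\<lambda>t. (X t, Y t)) \<in> couplings (distr M borel X) (distr M borel Y)"
proof -
  interpret prob_space M by fact
  show ?thesis
    unfolding couplings_def
    by (auto intro!: prob_space_distr simp: distr_distr comp_def borel_prod[symmetric])
qed

text \<open>Under a coupling, almost every pair ends in \<open>T\<close>, so mass starting at \<open>u\<close> travels at least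
  the distance from \<open>u\<close> to \<open>T\<close>. This lower bound no longer depends on the coupling.\<close>

lemma transport_cost_ge_infdist:
  fixes \<mu> \<nu> :: "'a::polish_space measure"
  assumes P: "P \<in> couplings \<mu> \<nu>" and T: "T \<in> sets borel" and \<nu>: "AE v in \<nu>. v \<in> T"
  shows "(\<integral>\<^sup>+u. ennreal ((infdist u T)\<^sup>2) \<partial>\<mu>) \<le> (\<integral>\<^sup>+z. ennreal ((dist (fst z) (snd z))\<^sup>2) \<partial>P)"
proof -
  have [measurable_cong]: "sets P = sets borel" and \<mu>: "\<mu> = distr P borel fst"
    and \<nu>eq: "\<nu> = distr P borel snd"
    using P by (auto simp: couplings_def)
  have [measurable]: "fst \<in> borel_measurable P" "snd \<in> borel_measurable P"
    by (auto simp: measurable_cong_sets[OF \<open>sets P = sets borel\<close> refl] borel_prod[symmetric])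
  have [measurable]: "(\<lambda>u. infdist u T) \<in> borel_measurable borel"
    by (intro borel_measurable_continuous_onI continuous_intros)
  have "AE z in P. snd z \<in> T"
    using \<nu> T unfolding \<nu>eq by (subst (asm) AE_distr_iff) auto
  then have "AE z in P. ennreal ((infdist (fst z) T)\<^sup>2) \<le> ennreal ((dist (fst z) (snd z))\<^sup>2)"
    by eventually_elim
      (auto intro!: ennreal_leI power_mono infdist_le infdist_nonneg)
  then show ?thesis
    unfolding \<mu> by (subst nn_integral_distr) (auto intro: nn_integral_mono_AE)
qed

lemma atomic_in_wasserstein2_space:
  fixes X :: "nat \<Rightarrow> 'a::polish_space"
  assumes "\<And>n. dist x0 (X n) \<le> b"
  shows "distr (measure_pmf p) borel X \<in> wasserstein2_space"
proof -
  have "(\<integral>\<^sup>+x. ennreal ((dist x0 x)\<^sup>2) \<partial>distr (measure_pmf p) borel X)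
      = (\<integral>\<^sup>+n. ennreal ((dist x0 (X n))\<^sup>2) \<partial>measure_pmf p)"
    by (subst nn_integral_distr) auto
  also have "\<dots> \<le> (\<integral>\<^sup>+n. ennreal (b\<^sup>2) \<partial>measure_pmf p)"
    using assms by (intro nn_integral_mono ennreal_leI power_mono) auto
  also have "\<dots> < \<infinity>" by (simp add: measure_pmf.emeasure_space_1)
  finally show ?thesis
    unfolding wasserstein2_space_def
    by (auto intro!: measure_pmf.prob_space_distr)
qed

lemma nn_integral_pmf_nat_square:
  assumes "summable (\<lambda>n. pmf p n * (e n)\<^sup>2)"
  shows "(\<integral>\<^sup>+n. ennreal ((c * e n)\<^sup>2) \<partial>measure_pmf p) = ennreal (c\<^sup>2 * (\<Sum>n. pmf p n * (e n)\<^sup>2))"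
proof -
  have "(\<integral>\<^sup>+n. ennreal ((c * e n)\<^sup>2) \<partial>measure_pmf p)
      = (\<Sum>n. ennreal (c\<^sup>2 * (pmf p n * (e n)\<^sup>2)))"
    unfolding nn_integral_measure_pmf nn_integral_count_space_nat
    by (intro suminf_cong) (simp add: ennreal_mult[symmetric] power_mult_distrib ac_simps)
  also have "\<dots> = ennreal (\<Sum>n. c\<^sup>2 * (pmf p n * (e n)\<^sup>2))"
    using assms by (intro suminf_ennreal2 summable_mult) auto
  also have "\<dots> = ennreal (c\<^sup>2 * (\<Sum>n. pmf p n * (e n)\<^sup>2))"
    using assms by (simp add: suminf_mult)
  finally show ?thesis .
qed

text \<open>The coupling that moves the \<open>n\<close>-th atom of the first measure onto the \<open>n\<close>-th atom of the second
  gives the upper bound. For the lower bound, \<open>T\<close> in the previous estimate is the set of all atoms of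
  the second measure, and the hypothesis \<open>lower\<close> says that \<open>X n\<close> has no atom \<open>Y m\<close> nearby,
  whether \<open>m = n\<close> or not. The two together say that the diagonal coupling is optimal up to
  the factor \<open>B / A\<close> in the distance.\<close>

lemma wasserstein2_dist_atomic_bounds:
  fixes X Y :: "nat \<Rightarrow> 'a::polish_space"
  assumes "0 \<le> A" "0 \<le> B" and e: "\<And>n. 0 \<le> e n"
    and summ: "summable (\<lambda>n. pmf p n * (e n)\<^sup>2)"
    and lower: "\<And>n m. A * e n \<le> dist (X n) (Y m)"
    and upper: "\<And>n. dist (X n) (Y n) \<le> B * e n"
  defines "W \<equiv> wasserstein2_dist (distr (measure_pmf p) borel X) (distr (measure_pmf p) borel Y)"
  shows "A * sqrt (\<Sum>n. pmf p n * (e n)\<^sup>2) \<le> W" and "W \<le> B * sqrt (\<Sum>n. pmf p n * (e n)\<^sup>2)"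
proof -
  define \<mu> where "\<mu> = distr (measure_pmf p) borel X"
  define \<nu> where "\<nu> = distr (measure_pmf p) borel Y"
  define S where "S = (\<Sum>n. pmf p n * (e n)\<^sup>2)"
  define I where "I = (INF P\<in>couplings \<mu> \<nu>. \<integral>\<^sup>+z. ennreal ((dist (fst z) (snd z))\<^sup>2) \<partial>P)"
  have "0 \<le> S" unfolding S_def using summ by (intro suminf_nonneg) auto
  have "I \<le> (\<integral>\<^sup>+z. ennreal ((dist (fst z) (snd z))\<^sup>2) \<partial>distr (measure_pmf p) borel (\<lambda>n. (X n, Y n)))"
    unfolding I_def \<mu>_def \<nu>_def
    by (intro INF_lower diagonal_coupling) (auto intro: measure_pmf.prob_space_axioms)
  also have "\<dots> = (\<integral>\<^sup>+n. ennreal ((dist (X n) (Y n))\<^sup>2) \<partial>measure_pmf p)"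
    by (subst nn_integral_distr) (auto simp: borel_prod[symmetric] space_pair_measure)
  also have "\<dots> \<le> (\<integral>\<^sup>+n. ennreal ((B * e n)\<^sup>2) \<partial>measure_pmf p)"
    using upper by (intro nn_integral_mono ennreal_leI power_mono) auto
  also have "\<dots> = ennreal (B\<^sup>2 * S)"
    unfolding S_def by (rule nn_integral_pmf_nat_square[OF summ])
  finally have I_le: "I \<le> ennreal (B\<^sup>2 * S)" .
  have I_ge: "ennreal (A\<^sup>2 * S) \<le> I"
    unfolding I_def
  proof (rule INF_greatest)
    fix P assume P: "P \<in> couplings \<mu> \<nu>"
    have T: "range Y \<in> sets borel"
      by (rule sets.countable) auto
    have "AE v in \<nu>. v \<in> range Y"
      unfolding \<nu>_def using T by (subst AE_distr_iff) auto
    note cost = transport_cost_ge_infdist[OF P T this]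
    have inf: "A * e n \<le> infdist (X n) (range Y)" for n
      unfolding infdist_def using lower by (auto intro!: cINF_greatest)
    have "ennreal (A\<^sup>2 * S) = (\<integral>\<^sup>+n. ennreal ((A * e n)\<^sup>2) \<partial>measure_pmf p)"
      unfolding S_def by (rule nn_integral_pmf_nat_square[OF summ, symmetric])
    also have "\<dots> \<le> (\<integral>\<^sup>+n. ennreal ((infdist (X n) (range Y))\<^sup>2) \<partial>measure_pmf p)"
      using inf e \<open>0 \<le> A\<close> by (intro nn_integral_mono ennreal_leI power_mono) auto
    also have "\<dots> = (\<integral>\<^sup>+u. ennreal ((infdist u (range Y))\<^sup>2) \<partial>\<mu>)"
      unfolding \<mu>_def
      by (subst nn_integral_distr)
        (auto intro!: borel_measurable_continuous_onI continuous_intros)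
    also note cost
    finally show "ennreal (A\<^sup>2 * S) \<le> (\<integral>\<^sup>+z. ennreal ((dist (fst z) (snd z))\<^sup>2) \<partial>P)" .
  qed
  have W: "W = sqrt (enn2real I)"
    unfolding W_def wasserstein2_dist_def I_def \<mu>_def \<nu>_def ..
  have "I < \<top>" using I_le by (simp add: le_less_trans)
  then have "A\<^sup>2 * S \<le> enn2real I" "enn2real I \<le> B\<^sup>2 * S"
    using enn2real_mono[OF I_ge] enn2real_mono[OF I_le] \<open>0 \<le> S\<close> by auto
  then have "sqrt (A\<^sup>2 * S) \<le> W" "W \<le> sqrt (B\<^sup>2 * S)"
    unfolding W by simp_all
  then show "A * sqrt (\<Sum>n. pmf p n * (e n)\<^sup>2) \<le> W" "W \<le> B * sqrt (\<Sum>n. pmf p n * (e n)\<^sup>2)"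
    using \<open>0 \<le> A\<close> \<open>0 \<le> B\<close> by (simp_all add: real_sqrt_mult S_def)
qed

section \<open>Embedding the Hilbert cube\<close>

lemma exists_pmf_nat:
  fixes w :: "nat \<Rightarrow> real"
  assumes "\<And>n. 0 \<le> w n" and "w sums 1"
  obtains p where "\<And>n. pmf p n = w n"
proof
  have "(\<integral>\<^sup>+n. ennreal (w n) \<partial>count_space UNIV) = ennreal (\<Sum>n. w n)"
    unfolding nn_integral_count_space_nat using assms
    by (intro suminf_ennreal2) (auto simp: sums_iff)
  then show "pmf (embed_pmf w) n = w n" for n
    using assms by (intro pmf_embed_pmf) (auto simp: sums_iff)
qed

text \<open>The conditions \<open>r n ^ d = w n\<close> and \<open>w n * (r n)\<^sup>2 = \<kappa>\<^sup>2 * (a n)\<^sup>2\<close> force \<open>w n powr (1 + 2 / d)\<close> to be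
  proportional to \<open>(a n)\<^sup>2\<close>, that is \<open>w n\<close> proportional to \<open>a n powr q\<close> with
  \<open>q * (1 + 2 / d) = 2\<close>; the factor \<open>1 / S\<close> normalises the sum.\<close>

lemma exists_weights_and_radii:
  fixes a :: "nat \<Rightarrow> real" and d :: nat
  assumes pos: "\<And>n. 0 < a n" and "0 < d"
    and ell: "summable (\<lambda>n. a n powr (2 * real d / (real d + 2)))"
  obtains w r :: "nat \<Rightarrow> real" and \<kappa> :: real
  where "\<And>n. 0 < w n" "w sums 1" "\<And>n. 0 < r n" "\<And>n. r n ^ d = w n"
    "0 < \<kappa>" "\<And>n. w n * (r n)\<^sup>2 = \<kappa>\<^sup>2 * (a n)\<^sup>2"
proof -
  define q where "q = 2 * real d / (real d + 2)"
  define S where "S = (\<Sum>n. a n powr q)"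
  define w where "w n = a n powr q / S" for n
  define r where "r n = w n powr (1 / real d)" for n
  define \<kappa> where "\<kappa> = S powr (- (1 + 2 / real d) / 2)"
  have summ: "summable (\<lambda>n. a n powr q)" using ell by (simp add: q_def)
  have apos: "0 < a n powr q" for n using pos[of n] by simp
  have "0 < S" unfolding S_def using apos summ by (intro suminf_pos) auto
  have w: "0 < w n" for n using apos \<open>0 < S\<close> by (simp add: w_def)
  have "w sums (S / S)"
    unfolding w_def using summ by (intro sums_divide) (simp add: S_def summable_sums)
  then have "w sums 1" using \<open>0 < S\<close> by simp
  have r: "0 < r n" for n using w[of n] by (simp add: r_def)
  have "r n ^ d = w n" for n
    using w[of n] \<open>0 < d\<close> r[of n] by (simp add: r_def powr_realpow[symmetric] powr_powr)
  moreover have "w n * (r n)\<^sup>2 = \<kappa>\<^sup>2 * (a n)\<^sup>2" for n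
  proof -
    have "(r n)\<^sup>2 = w n powr (2 / real d)"
      using r[of n] by (simp add: r_def powr_realpow[symmetric] powr_powr)
    then have "w n * (r n)\<^sup>2 = w n powr (1 + 2 / real d)"
      using w[of n] by (simp add: powr_add)
    also have "\<dots> = (a n powr q) powr (1 + 2 / real d) / S powr (1 + 2 / real d)"
      unfolding w_def using apos \<open>0 < S\<close> by (simp add: powr_divide less_imp_le)
    also have "q * (1 + 2 / real d) = 2"
      unfolding q_def using \<open>0 < d\<close> by (simp add: divide_simps)
    then have "(a n powr q) powr (1 + 2 / real d) = (a n)\<^sup>2"
      using pos[of n] by (simp add: powr_powr)
    also have "(a n)\<^sup>2 / S powr (1 + 2 / real d) = \<kappa>\<^sup>2 * (a n)\<^sup>2"
    proof -
      have "\<kappa>\<^sup>2 = S powr (- (1 + 2 / real d))"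
        using \<open>0 < S\<close> by (simp add: \<kappa>_def power2_eq_square powr_add[symmetric])
      then show ?thesis by (simp only: powr_minus divide_inverse mult.commute)
    qed
    finally show ?thesis .
  qed
  moreover have "0 < \<kappa>" using \<open>0 < S\<close> by (simp add: \<kappa>_def)
  ultimately show ?thesis using that w \<open>w sums 1\<close> r by blast
qed

text \<open>The \<open>n\<close>-th copy of the cube has its corner at \<open>z n / 2\<close> and side \<open>r n / 16\<close>, where the points \<open>z n\<close>
  are separated by \<open>r n / 4\<close>. Halving \<open>z n\<close> leaves room for the copies inside the unit cube and keeps
  their corners separated, in some coordinate, by the maximum of \<open>r m / 8\<close> and \<open>r n / 8\<close>. In that
  coordinate, points of the two copies differ from their corners by amounts between 0 and that
  maximum halved, and so the copies remain separated by \<open>r n / 16\<close>.\<close>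

lemma hilbert_cube_embeds_in_wasserstein2_space:
  fixes a :: "nat \<Rightarrow> real" and f :: "real ^ 'd::finite \<Rightarrow> 'x::polish_space"
  assumes pos: "\<And>n. 0 < a n"
    and ell: "summable (\<lambda>n. a n powr (2 * real CARD('d) / (real CARD('d) + 2)))"
    and f: "bilipschitz_embedding unit_cube dist UNIV dist f"
  shows "\<exists>g. bilipschitz_embedding (hilbert_cube (unit_cube :: (real ^ 'd) set))
      (hilbert_cube_dist a) (wasserstein2_space :: 'x measure set) wasserstein2_dist g"
proof -
  let ?d = "real CARD('d)"
  have d: "1 \<le> ?d" by (simp add: Suc_leI)
  obtain w r \<kappa> where w: "\<And>n. 0 < w n" "w sums 1" and r: "\<And>n. 0 < r n" "\<And>n. r n ^ CARD('d) = w n"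
    and \<kappa>: "0 < \<kappa>" "\<And>n. w n * (r n)\<^sup>2 = \<kappa>\<^sup>2 * (a n)\<^sup>2"
    using exists_weights_and_radii[OF pos _ ell] by auto
  obtain p where p: "\<And>n. pmf p n = w n"
    using exists_pmf_nat[OF less_imp_le[OF w(1)] w(2)] by blast
  have r1: "r n \<le> 1" for n
  proof (rule ccontr)
    assume "\<not> ?thesis"
    then have "1 < r n ^ CARD('d)" by (simp add: one_less_power)
    then show False using r(2)[of n] p[of n] pmf_le_1[of p n] by simp
  qed
  \<comment> \<open>The excluded cubes have total volume \<open>(1/2) ^ CARD('d)\<close>, less than that of the unit cube.\<close>
  have eq: "(2 * (r n / 4)) ^ CARD('d) = (1/2) ^ CARD('d) * w n" for n
    by (simp add: r(2)[symmetric] power_mult_distrib[symmetric])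
  have "(\<lambda>n. (2 * (r n / 4)) ^ CARD('d)) sums ((1/2) ^ CARD('d) * 1)"
    unfolding eq using w(2) by (rule sums_mult)
  moreover have "(1/2::real) ^ CARD('d) < 1" by (simp add: power_less_one_iff)
  ultimately obtain z :: "nat \<Rightarrow> real ^ 'd" where z: "\<And>n. z n \<in> unit_cube"
    and sep: "\<And>m n. m \<noteq> n \<Longrightarrow> \<exists>i. max (r m / 4) (r n / 4) \<le> \<bar>z m $ i - z n $ i\<bar>"
    using separated_points_in_unit_cube[of "\<lambda>n. r n / 4", where 'd = 'd] r(1)
    by (auto simp: sums_iff)
  define h where "h n x = (1/2) *\<^sub>R z n + (r n / 16) *\<^sub>R x" for n and x :: "real ^ 'd"
  have h_cube: "h n x \<in> unit_cube" if "x \<in> unit_cube" for n x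
  proof -
    have "0 \<le> h n x $ i \<and> h n x $ i \<le> 1" for i
    proof -
      have "0 \<le> z n $ i" "z n $ i \<le> 1" "0 \<le> x $ i" "x $ i \<le> 1"
        using z[of n] that by (auto simp: unit_cube_def)
      moreover have "0 \<le> r n * x $ i" "r n * x $ i \<le> 1"
        using r(1)[of n] r1[of n] calculation by (auto intro: mult_le_one less_imp_le)
      ultimately show ?thesis by (simp add: h_def)
    qed
    then show ?thesis by (simp add: unit_cube_def)
  qed
  have h_same: "dist (h n x) (h n y) = r n / 16 * dist x y" for n x y
    using r(1)[of n] by (simp add: h_def dist_norm scaleR_diff_right[symmetric])
  have h_diff: "r n / 16 \<le> dist (h n x) (h m y)"
    if "m \<noteq> n" "x \<in> unit_cube" "y \<in> unit_cube" for m n x y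
  proof -
    obtain i where i: "max (r m / 4) (r n / 4) \<le> \<bar>z m $ i - z n $ i\<bar>"
      using sep[OF \<open>m \<noteq> n\<close>] by blast
    have xy: "0 \<le> x $ i" "x $ i \<le> 1" "0 \<le> y $ i" "y $ i \<le> 1"
      using that by (auto simp: unit_cube_def)
    have "0 \<le> r n * x $ i" "r n * x $ i \<le> r n" "0 \<le> r m * y $ i" "r m * y $ i \<le> r m"
      using xy r(1)[of n] r(1)[of m] by (auto simp: mult_left_le)
    then have "\<bar>r n * x $ i - r m * y $ i\<bar> \<le> max (r m) (r n)"
      by (auto simp: abs_le_iff max_def)
    moreover have "max (r m) (r n) \<le> 4 * \<bar>z m $ i - z n $ i\<bar>" using i by auto
    moreover have "\<bar>u - v\<bar> / 2 - \<bar>w\<bar> / 16 \<le> \<bar>(v - u) / 2 + w / 16\<bar>" for u v w :: real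
      unfolding abs_if by (auto simp: field_simps)
    moreover have "\<rho> / 16 \<le> t" if "b \<le> R" "R \<le> 4 * D" "D / 2 - b / 16 \<le> t" "\<rho> \<le> R"
      for R b D t \<rho> :: real
      using that by linarith
    ultimately have "r n / 16 \<le> \<bar>(z n $ i - z m $ i) / 2 + (r n * x $ i - r m * y $ i) / 16\<bar>"
      using max.cobounded2[of "r n" "r m"] by blast
    also have "(z n $ i - z m $ i) / 2 + (r n * x $ i - r m * y $ i) / 16 = (h n x - h m y) $ i"
      by (simp add: h_def field_simps)
    also have "\<bar>(h n x - h m y) $ i\<bar> \<le> dist (h n x) (h m y)"
      unfolding dist_norm by (rule component_le_norm_cart)
    finally show ?thesis .
  qed
  obtain C where "1 \<le> C" and C: "\<And>x y. x \<in> unit_cube \<Longrightarrow> y \<in> unit_cube \<Longrightarrow>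
      inverse C * dist x y \<le> dist (f x) (f y) \<and> dist (f x) (f y) \<le> C * dist x y"
    using f unfolding bilipschitz_embedding_def by blast
  define g where "g x = distr (measure_pmf p) borel (\<lambda>n. f (h n (x n)))" for x
  have memX: "x n \<in> unit_cube" if "x \<in> hilbert_cube unit_cube" for x and n :: nat
    using that by (simp add: hilbert_cube_def)
  have in_W: "g x \<in> wasserstein2_space" if "x \<in> hilbert_cube unit_cube" for x
    unfolding g_def
  proof (rule atomic_in_wasserstein2_space)
    fix n
    have "0 \<in> (unit_cube :: (real ^ 'd) set)" by (simp add: unit_cube_def)
    moreover note hx = h_cube[OF memX[OF that], of n n]
    ultimately have "dist (f 0) (f (h n (x n))) \<le> C * dist 0 (h n (x n))"
      using C by blast
    also have "\<dots> \<le> C * ?d"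
      using \<open>1 \<le> C\<close> by (intro mult_left_mono unit_cube_dist_le hx) (auto simp: unit_cube_def)
    finally show "dist (f 0) (f (h n (x n))) \<le> C * ?d" .
  qed
  \<comment> \<open>The factor \<open>?d\<close> bounds the diameter of the cube; it makes \<open>A\<close> small enough for atoms in
    different copies.\<close>
  define A where "A = inverse C / (16 * ?d)"
  define B where "B = C / 16"
  have AB: "0 < A" "0 < B" using \<open>1 \<le> C\<close> by (auto simp: A_def B_def)
  have bounds: "0 \<le> hilbert_cube_dist a x y"
    "A * \<kappa> * hilbert_cube_dist a x y \<le> wasserstein2_dist (g x) (g y)"
    "wasserstein2_dist (g x) (g y) \<le> B * \<kappa> * hilbert_cube_dist a x y"
    if x: "x \<in> hilbert_cube unit_cube" and y: "y \<in> hilbert_cube unit_cube" for x y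
  proof -
    define e where "e n = r n * dist (x n) (y n)" for n
    have e0: "0 \<le> e n" for n using r(1)[of n] by (simp add: e_def)
    have ed: "e n \<le> ?d * r n" for n
      using unit_cube_dist_le[OF memX[OF x] memX[OF y], of n n] r(1)[of n]
      by (simp add: e_def mult.commute)
    have we: "pmf p n * (e n)\<^sup>2 = \<kappa>\<^sup>2 * ((a n)\<^sup>2 * (dist (x n) (y n))\<^sup>2)" for n
      using \<kappa>(2)[of n] by (simp add: p e_def power_mult_distrib mult.assoc[symmetric])
    have summ: "summable (\<lambda>n. pmf p n * (e n)\<^sup>2)"
    proof (rule summable_comparison_test')
      show "summable (\<lambda>n. ?d\<^sup>2 * w n)" using w(2) by (intro summable_mult) (auto simp: sums_iff)
      fix n :: nat
      have "e n \<le> ?d" using ed[of n] r1[of n] d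
        by (meson mult_left_le of_nat_0_le_iff order_trans)
      then have "(e n)\<^sup>2 \<le> ?d\<^sup>2" using e0 by (intro power_mono) auto
      then show "norm (pmf p n * (e n)\<^sup>2) \<le> ?d\<^sup>2 * w n"
        using w(1)[of n] by (simp add: p mult.commute)
    qed
    have lower: "A * e n \<le> dist (f (h n (x n))) (f (h m (y m)))" for n m
    proof -
      have "e n / (16 * ?d) \<le> dist (h n (x n)) (h m (y m))"
      proof (cases "m = n")
        case True
        have "e n \<le> e n * ?d" using d e0[of n] by (simp add: mult_le_cancel_left1)
        then have "e n / (16 * ?d) \<le> e n / 16"
          using d by (simp add: field_simps)
        then show ?thesis using True by (simp add: h_same e_def)
      next
        case False
        have "e n / (16 * ?d) \<le> r n / 16" using ed[of n] d by (simp add: field_simps)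
        then show ?thesis using h_diff[OF False memX[OF x] memX[OF y], of n m] by linarith
      qed
      then have "inverse C * (e n / (16 * ?d)) \<le> inverse C * dist (h n (x n)) (h m (y m))"
        using \<open>1 \<le> C\<close> by (intro mult_left_mono) auto
      also have "\<dots> \<le> dist (f (h n (x n))) (f (h m (y m)))"
        using C h_cube memX x y by blast
      finally show ?thesis by (simp add: A_def)
    qed
    have upper: "dist (f (h n (x n))) (f (h n (y n))) \<le> B * e n" for n
      using C[OF h_cube[OF memX[OF x]] h_cube[OF memX[OF y]], of n n n n]
      by (simp add: B_def e_def h_same)
    have "summable (\<lambda>n. (\<kappa>\<^sup>2 * ((a n)\<^sup>2 * (dist (x n) (y n))\<^sup>2)) / \<kappa>\<^sup>2)"
      using summ unfolding we by (rule summable_divide)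
    then have "summable (\<lambda>n. (a n)\<^sup>2 * (dist (x n) (y n))\<^sup>2)" using \<kappa>(1) by simp
    then have "0 \<le> (\<Sum>n. (a n)\<^sup>2 * (dist (x n) (y n))\<^sup>2)"
      and eq: "sqrt (\<Sum>n. pmf p n * (e n)\<^sup>2) = \<kappa> * hilbert_cube_dist a x y"
      unfolding we hilbert_cube_dist_def using \<kappa>(1)
      by (auto simp: suminf_mult real_sqrt_mult intro: suminf_nonneg)
    then show "0 \<le> hilbert_cube_dist a x y"
      by (simp add: hilbert_cube_dist_def)
    show "A * \<kappa> * hilbert_cube_dist a x y \<le> wasserstein2_dist (g x) (g y)"
      "wasserstein2_dist (g x) (g y) \<le> B * \<kappa> * hilbert_cube_dist a x y"
      using wasserstein2_dist_atomic_bounds[OF less_imp_le[OF AB(1)] less_imp_le[OF AB(2)]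
          e0 summ lower upper] eq
      by (simp_all add: g_def mult.assoc)
  qed
  have "bilipschitz_embedding (hilbert_cube (unit_cube :: (real ^ 'd) set))
      (hilbert_cube_dist a) (wasserstein2_space :: 'x measure set) wasserstein2_dist g"
    using bounds in_W AB \<kappa>(1)
    by (intro bilipschitz_embeddingI[where A = "A * \<kappa>" and B = "B * \<kappa>"]) auto
  then show ?thesis by blast
qed

theorem theorem1p5:
  fixes a :: "nat \<Rightarrow> real"
  assumes pos: "\<And>n. a n > 0"
    and ell: "summable (\<lambda>n. \<bar>a n\<bar> powr (2 * real CARD('d::finite) / (real CARD('d) + 2)))"
  shows "((\<exists>f. bilipschitz_embedding (unit_cube :: (real ^ 'd) set) dist
                 (UNIV :: 'x::polish_space set) dist f) \<longrightarrow>
          (\<exists>g. bilipschitz_embedding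
                 (hilbert_cube (unit_cube :: (real ^ 'd) set)) (hilbert_cube_dist a)
                 (wasserstein2_space :: 'x measure set) wasserstein2_dist g)) \<and>
         ((\<exists>\<A> :: ('x set \<times> ('x \<Rightarrow> real ^ 'd)) set. bilipschitz_atlas \<A>) \<longrightarrow>
          (\<exists>f. bilipschitz_embedding (unit_cube :: (real ^ 'd) set) dist
                 (UNIV :: 'x set) dist f))"
proof -
  have "\<bar>a n\<bar> = a n" for n using pos[of n] by simp
  then have "summable (\<lambda>n. a n powr (2 * real CARD('d) / (real CARD('d) + 2)))"
    using ell by simp
  then show ?thesis
    using hilbert_cube_embeds_in_wasserstein2_space[where a = a, OF pos]
      bilipschitz_atlas_imp_cube_embedding by blast
qed

end
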